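(* Let $\mathcal{A}$ be any alphabet set (a discrete set, finite or infinite, or a metric space $(\mathcal{A},d)$), let $(\Omega,\sigma)$ be a subshift of $(\mathcal{A}^{\mathbb{N}},\sigma)$, and let $\overline{\sigma}$ be the induced map on the hyperspace $\mathcal{K}(\Omega)$ of nonempty compact subsets of $\Omega$. If $(\Omega,\sigma)$ has a dense set of periodic points, then so does $(\mathcal{K}(\Omega),\overline{\sigma})$.
   Context: Sequences are indexed from $0$ and $\sigma(x_0x_1x_2\ldots)=x_1x_2x_3\ldots$. A subshift of $\mathcal{A}^{\mathbb{N}}$ is a nonempty closed subset $\Omega$ with $\sigma(\Omega)\subseteq\Omega$. The space $\mathcal{A}^{\mathbb{N}}$ carries the metric $D$, where $D(\bar x,\bar y)=\sum_{i=0}^\infty \frac{\delta(x_i,y_i)}{2^i}$ ($\delta$ the discrete metric) if $\mathcal{A}$ is a discrete alphabet, and $D(\bar x,\bar y)=\sum_{i=0}^\infty \frac{1}{2^i}\frac{d(x_i,y_i)}{1+d(x_i,y_i)}$ if $\mathcal{A}$ is a general metric space. $\mathcal{K}(\Omega)$ carries the Hausdorff metric $D_H$ induced by $D$, and $\overline{\sigma}(K)=\sigma(K)$. For a continuous $f:X\to X$, a point $x$ is periodic if $f^n(x)=x$ for some positive integer $n$. *)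

theory Defs
  imports "HOL-Analysis.Analysis"
begin

definition full_shift :: "'a set \<Rightarrow> (nat \<Rightarrow> 'a) set" where
  "full_shift A = {x. \<forall>i. x i \<in> A}"

definition shift :: "(nat \<Rightarrow> 'a) \<Rightarrow> (nat \<Rightarrow> 'a)" where
  "shift x = (\<lambda>i. x (Suc i))"

text \<open>A discrete alphabet and a metric alphabet get different formulas: for the discrete
  metric the second formula would give one half of the first.\<close>

definition seq_dist_discrete :: "(nat \<Rightarrow> 'a) \<Rightarrow> (nat \<Rightarrow> 'a) \<Rightarrow> real" where
  "seq_dist_discrete x y = (\<Sum>i. discrete_metric.dd (x i) (y i) / 2 ^ i)"

definition seq_dist_metric :: "('a \<Rightarrow> 'a \<Rightarrow> real) \<Rightarrow> (nat \<Rightarrow> 'a) \<Rightarrow> (nat \<Rightarrow> 'a) \<Rightarrow> real" where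
  "seq_dist_metric d x y = (\<Sum>i. 1 / 2 ^ i * (d (x i) (y i) / (1 + d (x i) (y i))))"

definition subshift :: "'a set \<Rightarrow> ((nat \<Rightarrow> 'a) \<Rightarrow> (nat \<Rightarrow> 'a) \<Rightarrow> real) \<Rightarrow> (nat \<Rightarrow> 'a) set \<Rightarrow> bool" where
  "subshift A D \<Omega> \<longleftrightarrow> \<Omega> \<noteq> {} \<and> closedin (Metric_space.mtopology (full_shift A) D) \<Omega> \<and> shift ` \<Omega> \<subseteq> \<Omega>"

definition hyperspace :: "'x topology \<Rightarrow> 'x set set" where
  "hyperspace T = {K. K \<noteq> {} \<and> compactin T K}"

text \<open>The suprema and infima below are real-valued, hence meaningful for nonempty sets and
  bounded \<open>d\<close>; the value \<open>0\<close> for an empty argument is a dummy, as for \<^const>\<open>infdist\<close>.\<close>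

definition hausdorff_dist :: "('x \<Rightarrow> 'x \<Rightarrow> real) \<Rightarrow> 'x set \<Rightarrow> 'x set \<Rightarrow> real" where
  "hausdorff_dist d K L =
     (if K = {} \<or> L = {} then 0
      else max (SUP x\<in>K. INF y\<in>L. d x y) (SUP y\<in>L. INF x\<in>K. d x y))"

definition hyperspace_topology :: "'x set \<Rightarrow> ('x \<Rightarrow> 'x \<Rightarrow> real) \<Rightarrow> 'x set topology" where
  "hyperspace_topology X d =
     Metric_space.mtopology (hyperspace (Metric_space.mtopology X d)) (hausdorff_dist d)"

definition induced_map :: "('x \<Rightarrow> 'x) \<Rightarrow> 'x set \<Rightarrow> 'x set" where
  "induced_map f K = f ` K"

definition periodic_points :: "'x set \<Rightarrow> ('x \<Rightarrow> 'x) \<Rightarrow> 'x set" where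
  "periodic_points X f = {x \<in> X. \<exists>n>0. (f ^^ n) x = x}"

definition dense_periodic_points :: "'x topology \<Rightarrow> ('x \<Rightarrow> 'x) \<Rightarrow> bool" where
  "dense_periodic_points T f \<longleftrightarrow> T closure_of periodic_points (topspace T) f = topspace T"


section \<open>Well-definedness of the metrics and of the induced map\<close>

text \<open>Both sequence metrics are of the form below, for a metric bounded by \<open>1\<close>.\<close>

lemma Metric_space_weighted_sum:
  assumes r: "Metric_space A r" and le1: "\<And>a b. r a b \<le> 1"
  defines "D \<equiv> \<lambda>x y. \<Sum>i. r (x i) (y i) / 2 ^ i"
  shows "Metric_space (full_shift A) D" "D x y \<le> 2"
    "D (shift x) (shift y) \<le> 2 * D x y"
proof -
  interpret Metric_space A r by (rule r)
  have geo: "summable (\<lambda>i. 1 / 2 ^ i :: real)"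
    using summable_geometric[of "1/2::real"] by (simp add: power_one_over)
  have sm: "summable (\<lambda>i. r (x i) (y i) / 2 ^ i)" for x y
    by (rule summable_comparison_test'[OF geo, of 0]) (simp add: divide_right_mono le1)
  have nn: "0 \<le> D x y" for x y
    unfolding D_def by (intro suminf_nonneg sm) simp
  show "Metric_space (full_shift A) D"
  proof
    show "0 \<le> D x y" for x y by (rule nn)
    show "D x y = D y x" for x y by (simp add: D_def commute)
    show "D x y = 0 \<longleftrightarrow> x = y" if "x \<in> full_shift A" "y \<in> full_shift A" for x y
    proof -
      have "D x y = 0 \<longleftrightarrow> (\<forall>i. r (x i) (y i) / 2 ^ i = 0)"
        unfolding D_def by (rule suminf_eq_zero_iff[OF sm]) simp
      also have "\<dots> \<longleftrightarrow> x = y"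
        using that by (auto simp: full_shift_def fun_eq_iff)
      finally show ?thesis .
    qed
    show "D x z \<le> D x y + D y z"
      if "x \<in> full_shift A" "y \<in> full_shift A" "z \<in> full_shift A" for x y z
    proof -
      have "D x z \<le> (\<Sum>i. r (x i) (y i) / 2 ^ i + r (y i) (z i) / 2 ^ i)"
        unfolding D_def using that
        by (intro suminf_le sm summable_add)
           (auto simp: full_shift_def add_divide_distrib[symmetric] intro!: divide_right_mono triangle)
      then show ?thesis unfolding D_def by (simp add: suminf_add[OF sm sm])
    qed
  qed
  have "D x y \<le> (\<Sum>i. 1 / 2 ^ i)"
    unfolding D_def by (intro suminf_le sm geo) (simp add: divide_right_mono le1)
  also have "\<dots> = 2"
    using suminf_geometric[of "1/2::real"] by (simp add: power_one_over)
  finally show "D x y \<le> 2" .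
  have "D x y = (\<Sum>i. r (x (Suc i)) (y (Suc i)) / 2 ^ Suc i) + r (x 0) (y 0)"
    unfolding D_def using suminf_split_head[OF sm, of x y] by simp
  also have "(\<Sum>i. r (x (Suc i)) (y (Suc i)) / 2 ^ Suc i) = D (shift x) (shift y) / 2"
    unfolding D_def shift_def
    using suminf_divide[OF sm[of "\<lambda>i. x (Suc i)" "\<lambda>i. y (Suc i)"], of 2] by (simp add: mult.commute)
  finally show "D (shift x) (shift y) \<le> 2 * D x y" by simp
qed

lemma Metric_space_bounded_form:
  assumes "Metric_space A d"
  shows "Metric_space A (\<lambda>a b. d a b / (1 + d a b))"
proof -
  interpret Metric_space A d by (rule assms)
  have nz: "1 + d a b > 0" for a b using nonneg[of a b] by linarith
  show ?thesis
  proof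
    show "0 \<le> d x y / (1 + d x y)" for x y by simp
    show "d x y / (1 + d x y) = d y x / (1 + d y x)" for x y by (simp add: commute)
    show "d x y / (1 + d x y) = 0 \<longleftrightarrow> x = y" if "x \<in> A" "y \<in> A" for x y
      using that nz[of x y] by simp
    show "d x z / (1 + d x z) \<le> d x y / (1 + d x y) + d y z / (1 + d y z)"
      if "x \<in> A" "y \<in> A" "z \<in> A" for x y z
    proof -
      let ?s = "d x y + d y z"
      have t: "d x z \<le> ?s" using that by (rule triangle)
      have s: "0 \<le> ?s" by simp
      have "d x z / (1 + d x z) \<le> ?s / (1 + ?s)"
        using t s nz[of x z] by (simp add: divide_simps algebra_simps add_pos_nonneg)
      also have "\<dots> = d x y / (1 + ?s) + d y z / (1 + ?s)"
        by (simp add: add_divide_distrib)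
      also have "\<dots> \<le> d x y / (1 + d x y) + d y z / (1 + d y z)"
        using nz[of x y] nz[of y z] by (intro add_mono divide_left_mono mult_pos_pos) (auto simp: add_pos_nonneg)
      finally show ?thesis .
    qed
  qed
qed

lemma seq_dist_facts:
  assumes "D = seq_dist_discrete \<or> (\<exists>d. Metric_space A d \<and> D = seq_dist_metric d)"
  shows "Metric_space (full_shift A) D" "D x y \<le> 2" "D (shift x) (shift y) \<le> 2 * D x y"
proof -
  obtain r where "Metric_space A r" "\<And>a b. r a b \<le> 1" "D = (\<lambda>x y. \<Sum>i. r (x i) (y i) / 2 ^ i)"
    using assms
  proof (elim disjE exE conjE)
    assume "D = seq_dist_discrete"
    then show ?thesis
      by (intro that[of discrete_metric.dd])
         (auto simp: metric_M_dd discrete_metric.dd_le1 fun_eq_iff seq_dist_discrete_def)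
  next
    fix d assume d: "Metric_space A d" and D: "D = seq_dist_metric d"
    have "d a b / (1 + d a b) \<le> 1" for a b
      using Metric_space.nonneg[OF d, of a b] by (simp add: divide_simps)
    with d D show ?thesis
      by (intro that[of "\<lambda>a b. d a b / (1 + d a b)"] Metric_space_bounded_form)
         (auto simp: fun_eq_iff seq_dist_metric_def mult.commute)
  qed
  then show "Metric_space (full_shift A) D" "D x y \<le> 2" "D (shift x) (shift y) \<le> 2 * D x y"
    using Metric_space_weighted_sum[of A r] by auto
qed

lemma Metric_space_hausdorff_dist:
  assumes X: "Metric_space X d" and B: "\<And>x y. d x y \<le> B"
  shows "Metric_space (hyperspace (Metric_space.mtopology X d)) (hausdorff_dist d)"
proof -
  interpret Metric_space X d by (rule X)
  define p where "p x L = (INF y\<in>L. d x y)" for x L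
  define e where "e K L = (SUP x\<in>K. p x L)" for K L
  have bdd: "bdd_below ((\<lambda>y. d x y) ` L)" for x L
    by (rule bdd_belowI[of _ 0]) auto
  have p_le: "p x L \<le> d x y" if "y \<in> L" for x y L
    unfolding p_def using that bdd by (simp add: cINF_lower)
  have p_ge: "c \<le> p x L" if "L \<noteq> {}" "\<And>y. y \<in> L \<Longrightarrow> c \<le> d x y" for c x L
    unfolding p_def using that by (simp add: cINF_greatest)
  have p_B: "p x L \<le> B" if "L \<noteq> {}" for x L
    using that p_le B order_trans by blast
  have p_e: "p x L \<le> e K L" if "x \<in> K" "L \<noteq> {}" for x K L
    unfolding e_def using that p_B by (intro cSUP_upper bdd_aboveI[of _ B]) auto
  have e_le: "e K L \<le> c" if "K \<noteq> {}" "\<And>x. x \<in> K \<Longrightarrow> p x L \<le> c" for c K L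
    unfolding e_def using that by (simp add: cSUP_least)
  have e_nn: "0 \<le> e K L" if "K \<noteq> {}" "L \<noteq> {}" for K L
  proof -
    obtain x where "x \<in> K" using \<open>K \<noteq> {}\<close> by auto
    moreover have "0 \<le> p x L" using that by (intro p_ge) auto
    ultimately show ?thesis using p_e that order_trans by blast
  qed
  have h: "hausdorff_dist d K L = (if K = {} \<or> L = {} then 0 else max (e K L) (e L K))" for K L
    by (simp add: hausdorff_dist_def e_def p_def commute)
  have sub: "K \<subseteq> L"
    if K: "K \<in> hyperspace mtopology" and L: "L \<in> hyperspace mtopology" and 0: "e K L \<le> 0" for K L
  proof
    fix x assume x: "x \<in> K"
    have KL: "K \<subseteq> X" "L \<subseteq> X" "L \<noteq> {}" "compactin mtopology L"
      using K L compactin_subset_topspace by (fastforce simp: hyperspace_def)+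
    then have "closedin mtopology L"
      using Hausdorff_space_mtopology compactin_imp_closedin by blast
    moreover have "\<exists>y\<in>L. y \<in> mball x r" if "r > 0" for r
    proof (rule ccontr)
      assume "\<not> ?thesis"
      then have "r \<le> p x L"
        using KL x by (intro p_ge) (auto simp: not_less subset_iff)
      with p_e[OF x \<open>L \<noteq> {}\<close>] 0 that show False by linarith
    qed
    ultimately show "x \<in> L"
      using KL x metric_closure_of[of L] by (auto simp: closure_of_closedin)
  qed
  have e_tri: "e K M \<le> e K L + e L M" if "K \<noteq> {}" "L \<noteq> {}" "M \<noteq> {}" "K \<subseteq> X" "L \<subseteq> X" "M \<subseteq> X" for K L M
  proof (rule e_le[OF \<open>K \<noteq> {}\<close>])
    fix x assume x: "x \<in> K"
    have "p x M - e L M \<le> d x y" if y: "y \<in> L" for y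
    proof -
      have "p x M - d x y \<le> p y M"
      proof (rule p_ge[OF \<open>M \<noteq> {}\<close>])
        fix z assume "z \<in> M"
        then show "p x M - d x y \<le> d y z"
          using p_le[of z M x] triangle[of x y z] x y \<open>K \<subseteq> X\<close> \<open>L \<subseteq> X\<close> \<open>M \<subseteq> X\<close> by fastforce
      qed
      then show ?thesis using p_e[OF y \<open>M \<noteq> {}\<close>] by linarith
    qed
    then have "p x M - e L M \<le> p x L" using \<open>L \<noteq> {}\<close> by (intro p_ge)
    then show "p x M \<le> e K L + e L M" using p_e[OF x \<open>L \<noteq> {}\<close>] by linarith
  qed
  have hyp: "K \<noteq> {} \<and> K \<subseteq> X" if "K \<in> hyperspace mtopology" for K
    using that compactin_subset_topspace by (fastforce simp: hyperspace_def)
  show ?thesis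
  proof
    show "0 \<le> hausdorff_dist d K L" for K L
      by (simp add: h e_nn le_max_iff_disj)
    show "hausdorff_dist d K L = hausdorff_dist d L K" for K L
      by (simp add: h max.commute)
    show "hausdorff_dist d K L = 0 \<longleftrightarrow> K = L"
      if KL: "K \<in> hyperspace mtopology" "L \<in> hyperspace mtopology" for K L
    proof
      assume "hausdorff_dist d K L = 0"
      then have "e K L \<le> 0" "e L K \<le> 0" using hyp KL by (auto simp: h max_def split: if_splits)
      with sub KL show "K = L" by blast
    next
      assume [simp]: "K = L"
      have "e L L \<le> 0"
        using hyp KL p_le by (intro e_le) (auto simp: subset_iff, metis mdist_zero)
      with e_nn show "hausdorff_dist d K L = 0" using hyp KL by (auto simp: h intro: antisym)
    qed
    show "hausdorff_dist d K M \<le> hausdorff_dist d K L + hausdorff_dist d L M"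
      if "K \<in> hyperspace mtopology" "L \<in> hyperspace mtopology" "M \<in> hyperspace mtopology" for K L M
    proof -
      have "e K M \<le> e K L + e L M" "e M K \<le> e M L + e L K"
        using hyp that by (auto intro!: e_tri)
      with hyp that show ?thesis by (auto simp: h)
    qed
  qed
qed

lemma subshift_Metric_space:
  assumes "D = seq_dist_discrete \<or> (\<exists>d. Metric_space A d \<and> D = seq_dist_metric d)"
    and "subshift A D \<Omega>"
  shows "Metric_space \<Omega> D"
    and "Metric_space (hyperspace (Metric_space.mtopology \<Omega> D)) (hausdorff_dist D)"
proof -
  interpret Metric_space "full_shift A" D by (rule seq_dist_facts(1)[OF assms(1)])
  have "\<Omega> \<subseteq> full_shift A"
    using assms(2) closedin_subset by (fastforce simp: subshift_def)
  then show 1: "Metric_space \<Omega> D" by (rule subspace)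
  show "Metric_space (hyperspace (Metric_space.mtopology \<Omega> D)) (hausdorff_dist D)"
    using 1 seq_dist_facts(2)[OF assms(1)] by (rule Metric_space_hausdorff_dist)
qed

lemma induced_map_hyperspace:
  assumes D: "D = seq_dist_discrete \<or> (\<exists>d. Metric_space A d \<and> D = seq_dist_metric d)"
    and \<Omega>: "subshift A D \<Omega>"
    and K: "K \<in> hyperspace (Metric_space.mtopology \<Omega> D)"
  shows "induced_map shift K \<in> hyperspace (Metric_space.mtopology \<Omega> D)"
proof -
  interpret Metric_space \<Omega> D by (rule subshift_Metric_space(1)[OF D \<Omega>])
  have "continuous_map mtopology mtopology shift"
  proof (subst metric_continuous_map[OF Metric_space_axioms], intro conjI ballI allI impI)
    show "shift ` \<Omega> \<subseteq> \<Omega>" using \<Omega> by (simp add: subshift_def)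
    fix x and \<epsilon> :: real assume "x \<in> \<Omega>" "0 < \<epsilon>"
    moreover have "D (shift x) (shift y) < \<epsilon>" if "D x y < \<epsilon> / 2" for y
      using seq_dist_facts(3)[OF D, of x y] that by linarith
    ultimately show "\<exists>\<delta>>0. \<forall>y. y \<in> \<Omega> \<and> D x y < \<delta> \<longrightarrow> D (shift x) (shift y) < \<epsilon>"
      by (intro exI[of _ "\<epsilon> / 2"]) auto
  qed
  with K show ?thesis
    by (auto simp: hyperspace_def induced_map_def intro: image_compactin)
qed

end

theory Submission
  imports Defs
begin

text \<open>A compact set \<open>K\<close> has a finite \<open>\<epsilon>\<close>-net. Moving each point of the net to a nearby periodic
  point gives a finite set of periodic points close to \<open>K\<close>, and it is mapped to itself by the
  iterate whose exponent is the product of the periods.\<close>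

lemma induced_map_funpow: "(induced_map f ^^ n) K = (f ^^ n) ` K"
  by (induction n) (simp_all add: induced_map_def image_comp)

lemma funpow_fixed_mult:
  assumes "(f ^^ n) x = x"
  shows "(f ^^ (n * k)) x = x"
proof (induction k)
  case (Suc k)
  then show ?case using assms by (simp add: funpow_add)
qed simp

lemma finite_common_period:
  assumes "finite L" and "\<And>x. x \<in> L \<Longrightarrow> \<exists>n>0. (f ^^ n) x = x"
  shows "\<exists>n>0. \<forall>x\<in>L. (f ^^ n) x = x"
  using assms
proof (induction L)
  case (insert a L)
  then obtain n m where "n > 0" "\<forall>x\<in>L. (f ^^ n) x = x" "m > 0" "(f ^^ m) a = a"
    by (metis insertCI)
  then have "n * m > 0" "\<forall>x\<in>insert a L. (f ^^ (n * m)) x = x"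
    using funpow_fixed_mult[of n f _ m] funpow_fixed_mult[of m f _ n] by (auto simp: mult.commute)
  then show ?case by blast
qed auto

text \<open>Reduces a Hausdorff bound to finding, for each point of either set, a partner within
  \<open>c\<close> in the other. Since \<open>d\<close> is nonnegative everywhere, the real infima
  are taken over sets bounded below, so each is at most the distance to the partner.\<close>

lemma hausdorff_dist_le:
  assumes "K \<noteq> {}" "L \<noteq> {}" and nonneg: "\<And>x y. 0 \<le> d x y"
    and "\<And>x. x \<in> K \<Longrightarrow> \<exists>y\<in>L. d x y \<le> c" and "\<And>y. y \<in> L \<Longrightarrow> \<exists>x\<in>K. d x y \<le> c"
  shows "hausdorff_dist d K L \<le> c"
proof -
  have bdd: "bdd_below (g ` S)" if "\<And>s. 0 \<le> g s" for g :: "'a \<Rightarrow> real" and S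
    using that by (auto intro: bdd_belowI[of _ 0])
  have "(INF y\<in>L. d x y) \<le> c" if "x \<in> K" for x
    using assms(4)[OF that] by (auto intro: cINF_lower2[OF bdd] nonneg)
  moreover have "(INF x\<in>K. d x y) \<le> c" if "y \<in> L" for y
    using assms(5)[OF that] by (auto intro: cINF_lower2[OF bdd] nonneg)
  ultimately show ?thesis
    using assms(1,2) by (simp add: hausdorff_dist_def cSUP_least)
qed

text \<open>The net argument works for any bounded metric. The bound \<open>B\<close> keeps the
  suprema in \<open>hausdorff_dist\<close> finite, which makes it a metric on the
  hyperspace.\<close>

lemma dense_periodic_points_hyperspace:
  assumes X: "Metric_space X d" and B: "\<And>x y. d x y \<le> B"
    and dense: "dense_periodic_points (Metric_space.mtopology X d) f"
  shows "dense_periodic_points (hyperspace_topology X d) (induced_map f)"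
proof -
  interpret Metric_space X d by (rule X)
  interpret H: Metric_space "hyperspace mtopology" "hausdorff_dist d"
    by (rule Metric_space_hausdorff_dist[OF X B])
  have near: "\<exists>p \<in> periodic_points X f. d x p < r" if "x \<in> X" "r > 0" for x r
  proof -
    have "x \<in> mtopology closure_of periodic_points X f"
      using dense that by (simp add: dense_periodic_points_def)
    with \<open>r > 0\<close> show ?thesis by (fastforce simp: metric_closure_of)
  qed
  have "\<exists>L \<in> periodic_points (hyperspace mtopology) (induced_map f). L \<in> H.mball K \<epsilon>"
    if K: "K \<in> hyperspace mtopology" and "\<epsilon> > 0" for K \<epsilon>
  proof -
    \<comment> \<open>One \<open>r\<close> pays for reaching the net, another for moving to a
      periodic point. The suprema only give the weak bound \<open>2 * r\<close>, so it has to lie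
      strictly below \<epsilon>.\<close>
    define r where "r = \<epsilon> / 3"
    have r: "r > 0" "2 * r < \<epsilon>" using \<open>\<epsilon> > 0\<close> by (auto simp: r_def)
    have Kne: "K \<noteq> {}" and Kc: "compactin mtopology K" using K by (auto simp: hyperspace_def)
    have KX: "K \<subseteq> X" using compactin_subset_topspace[OF Kc] by simp
    \<comment> \<open>The centres are taken inside \<open>K\<close>, so that each point of
      \<open>L\<close> below has a partner in \<open>K\<close>.\<close>
    obtain F where F: "finite F" "F \<subseteq> K" "K \<subseteq> (\<Union>x\<in>F. mball x r)"
      using compactin_imp_mtotally_bounded[OF Kc] r by (auto simp: mtotally_bounded_def)
    obtain q where q: "\<And>x. x \<in> F \<Longrightarrow> q x \<in> periodic_points X f \<and> d x (q x) < r"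
      using near[OF _ \<open>r > 0\<close>] F(2) KX by (metis subset_iff)
    define L where "L = q ` F"
    have L: "finite L" "L \<noteq> {}" "L \<subseteq> X" "\<And>y. y \<in> L \<Longrightarrow> \<exists>n>0. (f ^^ n) y = y"
      using F Kne q by (auto simp: L_def periodic_points_def)
    have LH: "L \<in> hyperspace mtopology"
      using L by (simp add: hyperspace_def finite_imp_compactin)
    obtain n where "n > 0" "\<forall>y\<in>L. (f ^^ n) y = y"
      using finite_common_period[of L f] L by blast
    \<comment> \<open>The iterate fixes \<open>L\<close> pointwise, hence as a set.\<close>
    then have "(induced_map f ^^ n) L = L" by (simp add: induced_map_funpow)
    then have "L \<in> periodic_points (hyperspace mtopology) (induced_map f)"
      using LH \<open>n > 0\<close> by (auto simp: periodic_points_def)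
    moreover have "hausdorff_dist d K L \<le> 2 * r"
    proof (rule hausdorff_dist_le)
      fix x assume "x \<in> K"
      then obtain z where z: "z \<in> F" "d z x < r" "x \<in> X" using F(3) by auto
      then have "d x (q z) \<le> d x z + d z (q z)"
        using q[OF z(1)] F(2) KX by (intro triangle) (auto simp: periodic_points_def)
      then show "\<exists>y\<in>L. d x y \<le> 2 * r"
        using q[OF z(1)] z by (auto simp: L_def commute[of x z] intro!: bexI[of _ z])
    next
      fix y assume "y \<in> L"
      \<comment> \<open>Here \<open>y\<close> is \<open>q z\<close> for some \<open>z\<close> in
        \<open>F\<close>, and \<open>z\<close> itself is the partner, already within
        \<open>r\<close>.\<close>
      then show "\<exists>x\<in>K. d x y \<le> 2 * r"
        using q F(2) r by (force simp: L_def)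
    qed (use Kne L in auto)
    ultimately show ?thesis using K LH r by (auto intro!: bexI[of _ L])
  qed
  then show ?thesis
    unfolding dense_periodic_points_def hyperspace_topology_def
    by (auto simp: H.metric_closure_of simp del: H.in_mball)
qed

theorem proposition3p9:
  fixes A :: "'a set" and \<Omega> :: "(nat \<Rightarrow> 'a) set"
    and D :: "(nat \<Rightarrow> 'a) \<Rightarrow> (nat \<Rightarrow> 'a) \<Rightarrow> real"
  assumes "D = seq_dist_discrete \<or> (\<exists>d. Metric_space A d \<and> D = seq_dist_metric d)"
    and "subshift A D \<Omega>"
    and "dense_periodic_points (Metric_space.mtopology \<Omega> D) shift"
  shows "dense_periodic_points (hyperspace_topology \<Omega> D) (induced_map shift)"
  \<comment> \<open>Both sequence metrics are bounded by 2, the sum of the weights, so the general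
    lemma applies with \<open>B\<close> equal to 2.\<close>
  using subshift_Metric_space(1)[OF assms(1,2)] seq_dist_facts(2)[OF assms(1)] assms(3)
  by (rule dense_periodic_points_hyperspace)

end
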